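(* Let $\Delta x>0$, $x_i\in\mathbb R$, and let $q_{i-\frac12},q_{i+\frac12},\bar q_i\in\mathbb R$ with $q_{i-\frac12}<q_{i+\frac12}$. Set $r:=\frac{q_{i+\frac12}-q_{i-\frac12}}{3}>0$ and assume $$\bar q_i>q_{i+\frac12}-r\qquad\text{or}\qquad \bar q_i<q_{i-\frac12}+r.$$ Then the function $$p_N(x)=q_{i-\frac12}+(q_{i+\frac12}-q_{i-\frac12})\left(\frac{x-x_i+\Delta x/2}{\Delta x}\right)^N,\qquad x_i-\frac{\Delta x}2<x<x_i+\frac{\Delta x}2,$$ with $N=\dfrac{q_{i+\frac12}-\bar q_i}{\bar q_i-q_{i-\frac12}}$ interpolates the point values at the cell boundaries, $$p_N\big(x_i-\tfrac{\Delta x}2\big)=q_{i-\frac12},\qquad p_N\big(x_i+\tfrac{\Delta x}2\big)=q_{i+\frac12},$$ is conservative, $$\frac1{\Delta x}\int_{x_i-\Delta x/2}^{x_i+\Delta x/2}p_N(x)\,\mathrm dx=\bar q_i,$$ and is monotone.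
   Context: The cell is $[x_{i-\frac12},x_{i+\frac12}]=[x_i-\frac{\Delta x}2,x_i+\frac{\Delta x}2]$; the numbers $q_{i\pm\frac12}$ are the given point values at its endpoints $x_i\pm\frac{\Delta x}2$, and $\bar q_i$ is the given cell average. The formula for $p_N$ is given on the open cell; its values at the endpoints are understood through the same formula.
   Formalization: The cell average is additionally assumed to lie strictly between the two point values; otherwise N is undefined or N ≤ 0, and interpolation at the left endpoint fails (for an average below the left value the integral also diverges). *)

theory Defs
  imports "HOL-Analysis.Analysis"
begin

definition power_exponent :: "real \<Rightarrow> real \<Rightarrow> real \<Rightarrow> real" where
  "power_exponent ql qr qbar = (qr - qbar) / (qbar - ql)"

text \<open>
  The cell has centre \<open>xi\<close> and width \<open>dx\<close>; \<open>ql\<close> and \<open>qr\<close> are the point values at its left and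
  right endpoint. The exponent is an arbitrary real number, hence \<open>powr\<close>. The library sets
  \<open>0 powr a = 0\<close> for every \<open>a\<close>, which is the usual power only for \<open>a > 0\<close>; the value at the
  left endpoint is therefore meaningful only for a positive exponent.
\<close>

definition power_recon :: "real \<Rightarrow> real \<Rightarrow> real \<Rightarrow> real \<Rightarrow> real \<Rightarrow> real \<Rightarrow> real" where
  "power_recon xi dx ql qr N x = ql + (qr - ql) * ((x - xi + dx / 2) / dx) powr N"

end

theory Submission
  imports Defs
begin

text \<open>
  In the normalised coordinate \<open>t = (x - xi) / dx + 1 / 2\<close>, which runs from 0 to 1 over the
  cell, the reconstruction is \<open>ql + (qr - ql) * t powr N\<close>. Since \<open>qbar\<close> lies strictly between
  the two point values, the exponent is positive, so \<open>t powr N\<close> increases from 0 to 1; this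
  gives both the interpolation property and monotonicity. The mean of \<open>t powr N\<close> over the unit
  interval is \<open>1 / (N + 1)\<close>, so the cell average is \<open>ql + (qr - ql) / (N + 1)\<close>. The exponent
  is the solution of the equation that sets this equal to \<open>qbar\<close>.
\<close>

lemma power_exponent_pos:
  assumes "ql < qbar" "qbar < qr"
  shows "power_exponent ql qr qbar > 0"
  using assms by (simp add: power_exponent_def)

lemma power_recon_left:
  "power_recon xi dx ql qr N (xi - dx / 2) = ql"
  by (simp add: power_recon_def)

lemma power_recon_right:
  assumes "dx > 0"
  shows "power_recon xi dx ql qr N (xi + dx / 2) = qr"
  using assms by (simp add: power_recon_def)

lemma mono_on_power_recon:
  assumes "dx > 0" "ql \<le> qr" "N \<ge> 0"
  shows "mono_on {xi - dx / 2..} (power_recon xi dx ql qr N)"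
  unfolding power_recon_def using assms
  by (intro mono_onI add_left_mono mult_left_mono powr_mono2 divide_right_mono) auto

text \<open>
  For \<open>N < 1\<close> the reconstruction has an infinite slope at the left endpoint, but a primitive
  needs only the exponent \<open>N + 1\<close>. The power rule for \<open>powr\<close> holds for a positive base, that
  is, in the open cell; the fundamental theorem of calculus is therefore used in the form that
  asks for continuity on the closed cell and differentiability in its interior.
\<close>

lemma has_integral_power_recon:
  assumes "dx > 0" "N > 0"
  shows "(power_recon xi dx ql qr N has_integral dx * (ql + (qr - ql) / (N + 1)))
           {xi - dx / 2..xi + dx / 2}"
proof -
  define P where
    "P x = ql * x + (qr - ql) * (dx / (N + 1)) * ((x - xi + dx / 2) / dx) powr (N + 1)" for x
  have "(power_recon xi dx ql qr N has_integral P (xi + dx / 2) - P (xi - dx / 2))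
          {xi - dx / 2..xi + dx / 2}"
  proof (rule fundamental_theorem_of_calculus_interior)
    show "xi - dx / 2 \<le> xi + dx / 2"
      using assms by simp
    show "continuous_on {xi - dx / 2..xi + dx / 2} P"
      unfolding P_def using assms
      by (intro continuous_intros continuous_on_powr') auto
    show "(P has_vector_derivative power_recon xi dx ql qr N x) (at x)"
      if "x \<in> {xi - dx / 2<..<xi + dx / 2}" for x
    proof -
      have "(x - xi + dx / 2) / dx > 0"
        using that assms by simp
      then have "(P has_real_derivative power_recon xi dx ql qr N x) (at x)"
        unfolding P_def power_recon_def using assms
        by (auto intro!: derivative_eq_intros)
      then show ?thesis
        by (simp add: has_real_derivative_iff_has_vector_derivative)
    qed
  qed
  also have "P (xi + dx / 2) - P (xi - dx / 2) = dx * (ql + (qr - ql) / (N + 1))"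
    using assms by (simp add: P_def field_simps)
  finally show ?thesis .
qed

lemma cell_mean_power_exponent:
  assumes "ql < qbar" "qbar < qr"
  shows "ql + (qr - ql) / (power_exponent ql qr qbar + 1) = qbar"
proof -
  have "power_exponent ql qr qbar + 1 = (qr - ql) / (qbar - ql)"
    using assms by (simp add: power_exponent_def field_simps)
  then show ?thesis
    using assms by simp
qed

theorem theorem5p2:
  fixes xi dx ql qr qbar r N :: real and p :: "real \<Rightarrow> real"
  assumes "dx > 0"
    and "ql < qr"
    and "r = (qr - ql) / 3"
    and "qbar > qr - r \<or> qbar < ql + r"
    and "ql < qbar" and "qbar < qr"
    and "N = power_exponent ql qr qbar"
    and "p = power_recon xi dx ql qr N"
  shows "p (xi - dx / 2) = ql \<and>
         p (xi + dx / 2) = qr \<and>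
         p integrable_on {xi - dx / 2..xi + dx / 2} \<and>
         (1 / dx) * integral {xi - dx / 2..xi + dx / 2} p = qbar \<and>
         mono_on {xi - dx / 2..xi + dx / 2} p"
proof -
  have "N > 0"
    using assms by (simp add: power_exponent_pos)
  then have int: "(p has_integral dx * qbar) {xi - dx / 2..xi + dx / 2}"
    using has_integral_power_recon[of dx N xi ql qr] cell_mean_power_exponent[of ql qbar qr] assms
    by simp
  have "mono_on {xi - dx / 2..} p"
    using mono_on_power_recon \<open>N > 0\<close> assms by simp
  then have "mono_on {xi - dx / 2..xi + dx / 2} p"
    by (rule mono_on_subset) auto
  moreover have "(1 / dx) * integral {xi - dx / 2..xi + dx / 2} p = qbar"
    using integral_unique[OF int] \<open>dx > 0\<close> by simp
  ultimately show ?thesis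
    using has_integral_integrable[OF int] power_recon_left power_recon_right assms by simp
qed

end
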